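(* Let $H$ be a connected $m$-uniform hypergraph and let $\bar{H}$ be a connected $k$-fold covering of $H$. Then $\mathbb{PS}_0(H)$ can be embedded as a $\mathbb{Z}_m$-submodule of $\mathbb{PS}_0(\bar{H})$, and hence $s(H)$ divides $s(\bar{H})$.
   Context: A hypergraph is $m$-uniform if every edge has $m$ vertices; connectedness is via walks through edges. A covering projection from $\bar H$ to $H$ is a surjective map $\varpi:V(\bar H)\to V(H)$ sending each edge bijectively onto an edge of $H$ such that for every vertex $\bar v$ the induced map from edges containing $\bar v$ to edges containing $\varpi(\bar v)$ is a bijection; if every vertex fibre has $k$ elements, $\bar H$ is a $k$-fold covering. For an $m$-uniform hypergraph $G$ on $v_1,\dots,v_n$, the incidence matrix $Z(G)$ is the $|E(G)|\times n$ matrix with entry $1$ at $(e,v)$ if $v\in e$ and $0$ otherwise, and $\mathbb{PS}_0(G)=\{x\in\mathbb{Z}_m^n: Z(G)x=\mathbf{0}\text{ over }\mathbb{Z}_m,\ x_1=0\}$. The adjacency tensor $\mathcal{A}(G)$ has entries $a_{i_1\cdots i_m}=\frac1{(m-1)!}$ if $\{v_{i_1},\dots,v_{i_m}\}\in E(G)$, $0$ otherwise. For an invertible diagonal matrix $D=\mathrm{diag}(d_1,\dots,d_n)$, $D^{-(m-1)}\mathcal{A}D$ denotes the tensor with entries $d_{i_1}^{-(m-1)}a_{i_1\cdots i_m}d_{i_2}\cdots d_{i_m}$. The stabilizing index $s(G)$ is the cardinality of the group $\{D \text{ invertible complex diagonal}: D^{-(m-1)}\mathcal{A}(G)D=\mathcal{A}(G),\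 d_{1}=1\}$; for connected $G$ it equals the number of eigenvectors (up to scalar) of $\mathcal{A}(G)$ associated with its spectral radius, and equals $|\mathbb{PS}_0(G)|$. *)

theory Defs
  imports Complex_Main "HOL-Library.FuncSet" "HOL-Algebra.Module" "HOL-Algebra.IntRing"
begin

record 'a hypergraph =
  verts :: "'a set"
  edges :: "'a set set"

definition uniform_hypergraph :: "nat \<Rightarrow> 'a hypergraph \<Rightarrow> bool" where
  "uniform_hypergraph m G \<longleftrightarrow>
     finite (verts G) \<and> edges G \<subseteq> Pow (verts G) \<and> (\<forall>e\<in>edges G. card e = m)"

(* The walk vs!0, es!0, vs!1, es!1, ..., vs!n, where n = length es. *)
definition is_walk :: "'a hypergraph \<Rightarrow> 'a list \<Rightarrow> 'a set list \<Rightarrow> bool" where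
  "is_walk G vs es \<longleftrightarrow>
     length vs = length es + 1 \<and> set vs \<subseteq> verts G \<and> set es \<subseteq> edges G \<and>
     (\<forall>i<length es. vs ! i \<in> es ! i \<and> vs ! (i + 1) \<in> es ! i)"

definition connected_hypergraph :: "'a hypergraph \<Rightarrow> bool" where
  "connected_hypergraph G \<longleftrightarrow>
     verts G \<noteq> {} \<and>
     (\<forall>u\<in>verts G. \<forall>v\<in>verts G. \<exists>vs es. is_walk G vs es \<and> hd vs = u \<and> last vs = v)"

definition covering_projection ::
    "'b hypergraph \<Rightarrow> 'a hypergraph \<Rightarrow> ('b \<Rightarrow> 'a) \<Rightarrow> bool" where
  "covering_projection Hb H p \<longleftrightarrow>
     p ` verts Hb = verts H \<and>
     (\<forall>e\<in>edges Hb. p ` e \<in> edges H \<and> inj_on p e) \<and>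
     (\<forall>v\<in>verts Hb. bij_betw (image p) {e \<in> edges Hb. v \<in> e} {e \<in> edges H. p v \<in> e})"

definition k_fold_covering :: "nat \<Rightarrow> 'b hypergraph \<Rightarrow> 'a hypergraph \<Rightarrow> bool" where
  "k_fold_covering k Hb H \<longleftrightarrow>
     (\<exists>p. covering_projection Hb H p \<and>
          (\<forall>v\<in>verts H. finite {w \<in> verts Hb. p w = v} \<and> card {w \<in> verts Hb. p w = v} = k))"

(* Matrices, vectors and tensors of a hypergraph are indexed by its vertices (and edges)
   themselves instead of by 1, ..., n; the distinguished vertex v_1 of the enumeration is
   the explicit parameter v1, the only place where the enumeration matters. *)

definition incidence_matrix :: "('r, 'c) ring_scheme \<Rightarrow> 'a set \<Rightarrow> 'a \<Rightarrow> 'r" where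
  "incidence_matrix R e v = (if v \<in> e then \<one>\<^bsub>R\<^esub> else \<zero>\<^bsub>R\<^esub>)"

(* The free module of R-valued vectors indexed by V.  The type of modules extends that of
   rings, so the record has multiplicative fields; they play no role in a module. *)
definition coord_module :: "('r, 'c) ring_scheme \<Rightarrow> 'a set \<Rightarrow> ('r, 'a \<Rightarrow> 'r) module" where
  "coord_module R V =
     \<lparr>carrier = V \<rightarrow>\<^sub>E carrier R,
      monoid.mult = undefined, one = undefined,
      zero = (\<lambda>v\<in>V. \<zero>\<^bsub>R\<^esub>), add = (\<lambda>x y. \<lambda>v\<in>V. x v \<oplus>\<^bsub>R\<^esub> y v),
      smult = (\<lambda>c x. \<lambda>v\<in>V. c \<otimes>\<^bsub>R\<^esub> x v)\<rparr>"

definition PS0 :: "nat \<Rightarrow> 'a hypergraph \<Rightarrow> 'a \<Rightarrow> (int set, 'a \<Rightarrow> int set) module" where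
  "PS0 m G v1 =
     (let R = ZFact (int m); M = coord_module R (verts G) in
      M\<lparr>carrier :=
          {x \<in> carrier M.
             (\<forall>e\<in>edges G. (\<Oplus>\<^bsub>R\<^esub>v\<in>verts G. incidence_matrix R e v \<otimes>\<^bsub>R\<^esub> x v) = \<zero>\<^bsub>R\<^esub>) \<and>
             x v1 = \<zero>\<^bsub>R\<^esub>}\<rparr>)"

definition module_hom ::
    "('r, 'c) ring_scheme \<Rightarrow> ('r, 'x, 'd) module_scheme \<Rightarrow> ('r, 'y, 'e) module_scheme \<Rightarrow> ('x \<Rightarrow> 'y) set"
  where
  "module_hom R M N =
     {f. f \<in> carrier M \<rightarrow> carrier N \<and>
         (\<forall>x\<in>carrier M. \<forall>y\<in>carrier M. f (x \<oplus>\<^bsub>M\<^esub> y) = f x \<oplus>\<^bsub>N\<^esub> f y) \<and>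
         (\<forall>c\<in>carrier R. \<forall>x\<in>carrier M. f (c \<odot>\<^bsub>M\<^esub> x) = c \<odot>\<^bsub>N\<^esub> f x)}"

(* The conjuncts module R M and module R N are needed because the predicate submodule
   does not itself require the ambient structure to be a module. *)
definition embeds_as_submodule ::
    "('r, 'c) ring_scheme \<Rightarrow> ('r, 'x, 'd) module_scheme \<Rightarrow> ('r, 'y, 'e) module_scheme \<Rightarrow> bool"
  where
  "embeds_as_submodule R M N \<longleftrightarrow>
     module R M \<and> module R N \<and>
     (\<exists>f\<in>module_hom R M N. inj_on f (carrier M) \<and> submodule (f ` carrier M) R N)"

(* A tensor of order m on the index set V is a function on the lists over V of length m. *)
definition tensor_indices :: "nat \<Rightarrow> 'a set \<Rightarrow> 'a list set" where
  "tensor_indices m V = {is. set is \<subseteq> V \<and> length is = m}"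

definition adjacency_tensor :: "nat \<Rightarrow> 'a hypergraph \<Rightarrow> 'a list \<Rightarrow> complex" where
  "adjacency_tensor m G is = (if set is \<in> edges G then 1 / fact (m - 1) else 0)"

(* The entry of D^{-(m-1)} A D at the index tuple, where D = diag(d). *)
definition diag_scaled_tensor ::
    "nat \<Rightarrow> ('a \<Rightarrow> complex) \<Rightarrow> ('a list \<Rightarrow> complex) \<Rightarrow> 'a list \<Rightarrow> complex" where
  "diag_scaled_tensor m d A is =
     d (hd is) powi (- (int m - 1)) * A is * prod_list (map d (tl is))"

(* An invertible diagonal matrix is given by its nonzero diagonal; being extensional on
   verts G makes d determined by the matrix, so that the cardinality below is right. *)
definition stabilizing_group :: "nat \<Rightarrow> 'a hypergraph \<Rightarrow> 'a \<Rightarrow> ('a \<Rightarrow> complex) set" where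
  "stabilizing_group m G v1 =
     {d \<in> verts G \<rightarrow>\<^sub>E (UNIV - {0}).
        (\<forall>is\<in>tensor_indices m (verts G).
           diag_scaled_tensor m d (adjacency_tensor m G) is = adjacency_tensor m G is) \<and>
        d v1 = 1}"

(* The group is finite whenever G is connected and m-uniform with m > 0. *)
definition stabilizing_index :: "nat \<Rightarrow> 'a hypergraph \<Rightarrow> 'a \<Rightarrow> nat" where
  "stabilizing_index m G v1 = card (stabilizing_group m G v1)"

end

(* A covering projection p maps every edge of the covering hypergraph bijectively onto an edge of
   H, so solutions of the defining equations of H pull back along p.  The pull-back x o p need not
   vanish at w1, but x o p - x (p w1) does, and it still solves the incidence equations because an
   edge contributes only m x (p w1) = 0.  This map is injective: its value at a vertex over v1
   recovers x (p w1), and p is surjective.  Multiplicatively, d |-> (d o p) / d (p w1) embeds one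
   stabilizing group into the other, and Lagrange's theorem gives the divisibility. *)
theory Submission
  imports Defs
begin

section \<open>Submodules, images of homomorphisms and coordinate modules\<close>

text \<open>Closure under negation need not be checked separately: the negative of \<open>a\<close>
  is \<open>a\<close> scaled by minus one.\<close>

lemma (in module) submoduleI_smult:
  assumes "S \<subseteq> carrier M" and "\<zero>\<^bsub>M\<^esub> \<in> S"
    and "\<And>a b. \<lbrakk>a \<in> S; b \<in> S\<rbrakk> \<Longrightarrow> a \<oplus>\<^bsub>M\<^esub> b \<in> S"
    and smult: "\<And>c a. \<lbrakk>c \<in> carrier R; a \<in> S\<rbrakk> \<Longrightarrow> c \<odot>\<^bsub>M\<^esub> a \<in> S"
  shows "submodule S R M"
proof (rule submoduleI)
  fix a assume a: "a \<in> S"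
  then have "a \<in> carrier M" using assms(1) by blast
  then have "\<ominus>\<^bsub>M\<^esub> a = (\<ominus> \<one>) \<odot>\<^bsub>M\<^esub> a" by (simp add: smult_l_minus)
  then show "\<ominus>\<^bsub>M\<^esub> a \<in> S" using smult[OF _ a, of "\<ominus> \<one>"] by simp
qed (use assms in auto)

lemma module_hom_image_submodule:
  assumes "module R M" and "module R N" and "f \<in> module_hom R M N"
  shows "submodule (f ` carrier M) R N"
proof -
  interpret M: module R M by fact
  interpret N: module R N by fact
  have f: "f x \<in> carrier N" if "x \<in> carrier M" for x
    using assms(3) that by (auto simp: module_hom_def)
  have add: "f (x \<oplus>\<^bsub>M\<^esub> y) = f x \<oplus>\<^bsub>N\<^esub> f y" if "x \<in> carrier M" "y \<in> carrier M" for x y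
    using assms(3) that by (auto simp: module_hom_def)
  have smult: "f (c \<odot>\<^bsub>M\<^esub> x) = c \<odot>\<^bsub>N\<^esub> f x" if "c \<in> carrier R" "x \<in> carrier M" for c x
    using assms(3) that by (auto simp: module_hom_def)
  \<comment> \<open>\<open>module_hom\<close> does not list preservation of zero among its
    conditions; it follows by scaling with the zero of \<open>R\<close>.\<close>
  have "f \<zero>\<^bsub>M\<^esub> = \<zero>\<^bsub>N\<^esub>"
    using smult[of "\<zero>\<^bsub>R\<^esub>" "\<zero>\<^bsub>M\<^esub>"] f by simp
  then have "\<zero>\<^bsub>N\<^esub> \<in> f ` carrier M"
    by (metis M.zero_closed imageI)
  then show ?thesis
    by (intro N.submoduleI_smult)
      (auto simp: f add[symmetric] smult[symmetric])
qed

lemma coord_module_module: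
  assumes "cring R"
  shows "module R (coord_module R V)"
proof -
  interpret cring R by fact
  have "abelian_group (coord_module R V)"
  proof (rule abelian_groupI, goal_cases)
    case (6 x)
    then have "x v \<in> carrier R" if "v \<in> V" for v
      using that by (auto simp: coord_module_def)
    then show ?case
      by (intro bexI[of _ "\<lambda>v\<in>V. \<ominus>\<^bsub>R\<^esub> x v"])
        (auto simp: coord_module_def l_neg intro!: restrict_ext)
  next
    \<comment> \<open>The law for the neutral element. Its right side is \<open>x\<close> itself and
      not a restricted function, so extensionality of \<open>x\<close> on \<open>V\<close> has to be
      invoked. The law for the unit scalar below is handled in the same way.\<close>
    case (5 x)
    then show ?case
      by (intro extensionalityI[of _ V]) (auto simp: coord_module_def PiE_iff)
  qed (auto simp: coord_module_def PiE_iff a_assoc intro!: restrict_ext intro: a_comm)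
  then show ?thesis
  proof (rule moduleI[OF assms], goal_cases)
    case (5 x)
    then show ?case
      by (intro extensionalityI[of _ V]) (auto simp: coord_module_def PiE_iff)
  qed (auto simp: coord_module_def PiE_iff l_distr r_distr m_assoc intro!: restrict_ext)
qed

text \<open>Translates one row of the matrix equation into a sum over the edge: the coefficients are
  zero off \<open>e\<close> and one on it.\<close>

lemma (in cring) finsum_incidence_matrix:
  assumes "finite V" and "e \<subseteq> V" and "x \<in> V \<rightarrow> carrier R"
  shows "(\<Oplus>v\<in>V. incidence_matrix R e v \<otimes> x v) = (\<Oplus>v\<in>e. x v)"
  using assms by (intro add.finprod_mono_neutral_cong_right) (auto simp: incidence_matrix_def Pi_iff subset_iff)

text \<open>An element is a coset of some integer \<open>a\<close> modulo the ideal generated by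
  \<open>m\<close>; its \<open>n\<close>-fold sum is the coset of \<open>n * a\<close>, and
  \<open>m * a\<close> lies in the ideal. This is why constant vectors sum to zero over an edge with
  \<open>m\<close> vertices.\<close>

lemma ZFact_card_mult:
  assumes "x \<in> carrier (ZFact (int m))"
  shows "[m] \<cdot>\<^bsub>ZFact (int m)\<^esub> x = \<zero>\<^bsub>ZFact (int m)\<^esub>"
proof -
  define I where "I = Idl\<^bsub>\<Z>\<^esub> {int m}"
  have Z: "ZFact (int m) = \<Z> Quot I" by (simp only: ZFact_def I_def)
  have I: "ideal I \<Z>" unfolding I_def by (rule int.genideal_ideal) simp
  \<comment> \<open>Stated for general \<open>n\<close> because it serves twice: with
    \<open>n = 0\<close> for the base of the induction, and with \<open>n = m\<close> for the
    conclusion.\<close>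
  then have zero: "\<zero>\<^bsub>ZFact (int m)\<^esub> = I +>\<^bsub>\<Z>\<^esub> (int n * a)" if "int m dvd int n * a" for n a
    using int.a_rcos_zero[OF I, of "int n * a"] that
    by (auto simp: Z FactRing_def I_def int_Idl dvd_def mult.commute)
  have "x \<in> a_rcosets\<^bsub>\<Z>\<^esub> I"
    using assms by (simp add: Z FactRing_def)
  then obtain a where x: "x = I +>\<^bsub>\<Z>\<^esub> a"
    unfolding A_RCOSETS_def' by blast
  have "[n] \<cdot>\<^bsub>ZFact (int m)\<^esub> x = I +>\<^bsub>\<Z>\<^esub> (int n * a)" for n
  proof (induction n)
    case (Suc n)
    have "[Suc n] \<cdot>\<^bsub>ZFact (int m)\<^esub> x = [n] \<cdot>\<^bsub>ZFact (int m)\<^esub> x \<oplus>\<^bsub>ZFact (int m)\<^esub> x"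
      by (simp add: add_pow_def)
    also have "\<dots> = (I +>\<^bsub>\<Z>\<^esub> (int n * a)) \<oplus>\<^bsub>ZFact (int m)\<^esub> (I +>\<^bsub>\<Z>\<^esub> a)"
      unfolding Suc by (simp only: x)
    also have "\<dots> = I +>\<^bsub>\<Z>\<^esub> (int n * a + a)"
      using ring_hom_add[OF ideal.rcos_ring_hom[OF I], of "int n * a" a] by (simp add: Z)
    also have "int n * a + a = int (Suc n) * a"
      by (simp add: algebra_simps)
    finally show ?case .
  next
    case 0
    show ?case using zero[of 0] by (simp add: add_pow_def)
  qed
  then show ?thesis
    using zero[of m a] by simp
qed

section \<open>The modules \<open>PS0\<close> and their embedding along a covering\<close>

lemma PS0_simps [simp]:
  "\<zero>\<^bsub>PS0 m G v1\<^esub> = (\<lambda>v\<in>verts G. \<zero>\<^bsub>ZFact (int m)\<^esub>)"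
  "x \<oplus>\<^bsub>PS0 m G v1\<^esub> y = (\<lambda>v\<in>verts G. x v \<oplus>\<^bsub>ZFact (int m)\<^esub> y v)"
  "c \<odot>\<^bsub>PS0 m G v1\<^esub> x = (\<lambda>v\<in>verts G. c \<otimes>\<^bsub>ZFact (int m)\<^esub> x v)"
  by (simp_all add: PS0_def Let_def coord_module_def)

lemma PS0_carrier_iff:
  assumes "uniform_hypergraph m G"
  shows "x \<in> carrier (PS0 m G v1) \<longleftrightarrow>
    x \<in> verts G \<rightarrow>\<^sub>E carrier (ZFact (int m)) \<and>
    (\<forall>e\<in>edges G. finsum (ZFact (int m)) x e = \<zero>\<^bsub>ZFact (int m)\<^esub>) \<and>
    x v1 = \<zero>\<^bsub>ZFact (int m)\<^esub>"
proof -
  interpret R: cring "ZFact (int m)" by (rule ZFact_is_cring)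
  have "(\<Oplus>\<^bsub>ZFact (int m)\<^esub>v\<in>verts G. incidence_matrix (ZFact (int m)) e v \<otimes>\<^bsub>ZFact (int m)\<^esub> x v)
      = finsum (ZFact (int m)) x e"
    if "e \<in> edges G" "x \<in> verts G \<rightarrow>\<^sub>E carrier (ZFact (int m))" for e
    using assms that by (intro R.finsum_incidence_matrix) (auto simp: uniform_hypergraph_def)
  then show ?thesis
    by (auto simp: PS0_def Let_def coord_module_def)
qed

text \<open>The module axioms are inherited from \<open>coord_module\<close>, of which the carrier
  is a submodule. That \<open>v1\<close> is a vertex matters: elsewhere the restricted vectors take
  the value \<open>undefined\<close> instead of zero.\<close>

lemma PS0_module:
  assumes G: "uniform_hypergraph m G" and v1: "v1 \<in> verts G"
  shows "module (ZFact (int m)) (PS0 m G v1)"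
proof -
  let ?R = "ZFact (int m)" and ?M = "coord_module (ZFact (int m)) (verts G)"
  let ?P = "PS0 m G v1"
  interpret R: cring ?R by (rule ZFact_is_cring)
  interpret M: module ?R ?M by (rule coord_module_module) (rule ZFact_is_cring)
  have sub: "e \<subseteq> verts G" if "e \<in> edges G" for e
    using G that by (auto simp: uniform_hypergraph_def)
  \<comment> \<open>The operations of the coordinate module return restricted functions; a sum over
    an edge does not see the restriction, since edges consist of vertices.\<close>
  have sum_restrict: "finsum ?R (restrict f (verts G)) e = finsum ?R f e"
    if "e \<in> edges G" "f \<in> verts G \<rightarrow> carrier ?R" for e f
    using sub[OF that(1)] that(2) by (intro R.finsum_cong') auto
  have "submodule (carrier ?P) ?R ?M"
  proof (rule M.submoduleI_smult)
    show "carrier ?P \<subseteq> carrier ?M"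
      by (auto simp: PS0_def Let_def)
    show "\<zero>\<^bsub>?M\<^esub> \<in> carrier ?P"
      using v1 by (simp add: PS0_carrier_iff[OF G] coord_module_def sum_restrict R.finsum_zero)
  next
    fix x y assume "x \<in> carrier ?P" "y \<in> carrier ?P"
    then have x: "x \<in> verts G \<rightarrow> carrier ?R" "x v1 = \<zero>\<^bsub>?R\<^esub>"
      "\<And>e. e \<in> edges G \<Longrightarrow> finsum ?R x e = \<zero>\<^bsub>?R\<^esub>"
      and y: "y \<in> verts G \<rightarrow> carrier ?R" "y v1 = \<zero>\<^bsub>?R\<^esub>"
      "\<And>e. e \<in> edges G \<Longrightarrow> finsum ?R y e = \<zero>\<^bsub>?R\<^esub>"
      by (auto simp: PS0_carrier_iff[OF G])
    have "finsum ?R (\<lambda>v. x v \<oplus>\<^bsub>?R\<^esub> y v) e = \<zero>\<^bsub>?R\<^esub>" if e: "e \<in> edges G" for e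
    proof -
      have "x \<in> e \<rightarrow> carrier ?R" "y \<in> e \<rightarrow> carrier ?R"
        using x(1) y(1) sub[OF e] by auto
      then show ?thesis by (simp add: R.finsum_addf x(3) y(3) e)
    qed
    then show "x \<oplus>\<^bsub>?M\<^esub> y \<in> carrier ?P"
      using x y v1 by (simp add: PS0_carrier_iff[OF G] coord_module_def sum_restrict Pi_iff)
  next
    fix c x assume c: "c \<in> carrier ?R" and "x \<in> carrier ?P"
    then have x: "x \<in> verts G \<rightarrow> carrier ?R" "x v1 = \<zero>\<^bsub>?R\<^esub>"
      "\<And>e. e \<in> edges G \<Longrightarrow> finsum ?R x e = \<zero>\<^bsub>?R\<^esub>"
      by (auto simp: PS0_carrier_iff[OF G])
    have "finsum ?R (\<lambda>v. c \<otimes>\<^bsub>?R\<^esub> x v) e = \<zero>\<^bsub>?R\<^esub>" if e: "e \<in> edges G" for e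
    proof -
      have "x \<in> e \<rightarrow> carrier ?R" "finite e"
        using x(1) sub[OF e] G by (auto simp: uniform_hypergraph_def intro: finite_subset)
      then show ?thesis using R.finsum_rdistr[of e c x] c x(3) e by simp
    qed
    then show "c \<odot>\<^bsub>?M\<^esub> x \<in> carrier ?P"
      using x c v1 by (simp add: PS0_carrier_iff[OF G] coord_module_def sum_restrict Pi_iff)
  qed
  \<comment> \<open>\<open>PS0\<close> is the coordinate module with only its carrier replaced,
    which is exactly the structure that this rule produces.\<close>
  from submodule.submodule_is_module[OF this M.module_axioms] show ?thesis
    by (simp add: PS0_def Let_def)
qed

lemma PS0_embeds_covering:
  assumes H: "uniform_hypergraph m H" and Hb: "uniform_hypergraph m Hb"
    and p: "covering_projection Hb H p"
    and v1: "v1 \<in> verts H" and w1: "w1 \<in> verts Hb"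
  shows "embeds_as_submodule (ZFact (int m)) (PS0 m H v1) (PS0 m Hb w1)"
proof -
  let ?R = "ZFact (int m)"
  let ?f = "\<lambda>x. \<lambda>w\<in>verts Hb. x (p w) \<ominus>\<^bsub>?R\<^esub> x (p w1)"
  interpret R: cring ?R by (rule ZFact_is_cring)
  have surj: "p ` verts Hb = verts H"
    using p by (simp add: covering_projection_def)
  then have pv: "p w \<in> verts H" if "w \<in> verts Hb" for w
    using that by blast
  have closed: "?f x \<in> carrier (PS0 m Hb w1)" if "x \<in> carrier (PS0 m H v1)" for x
  proof -
    from that have x: "x v \<in> carrier ?R" if "v \<in> verts H" for v
      using that by (auto simp: PS0_carrier_iff[OF H])
    have "finsum ?R (?f x) e = \<zero>\<^bsub>?R\<^esub>" if e: "e \<in> edges Hb" for e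
    proof -
      have sub: "e \<subseteq> verts Hb" and card: "card e = m"
        using Hb e by (auto simp: uniform_hypergraph_def)
      have pe: "p ` e \<in> edges H" "inj_on p e"
        using p e by (auto simp: covering_projection_def)
      have "finsum ?R (?f x) e = finsum ?R (\<lambda>w. x (p w) \<oplus>\<^bsub>?R\<^esub> (\<ominus>\<^bsub>?R\<^esub> x (p w1))) e"
        using sub by (intro R.finsum_cong') (auto simp: x pv w1 R.minus_eq)
      also have "\<dots> = finsum ?R (\<lambda>w. x (p w)) e \<oplus>\<^bsub>?R\<^esub> finsum ?R (\<lambda>w. \<ominus>\<^bsub>?R\<^esub> x (p w1)) e"
        using sub by (intro R.finsum_addf) (auto simp: x pv w1)
      also have "finsum ?R (\<lambda>w. x (p w)) e = finsum ?R x (p ` e)"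
        using sub by (intro R.finsum_reindex[symmetric] pe) (auto simp: x pv)
      also have "finsum ?R x (p ` e) = \<zero>\<^bsub>?R\<^esub>"
        using \<open>x \<in> carrier (PS0 m H v1)\<close> pe by (simp add: PS0_carrier_iff[OF H])
      \<comment> \<open>The shift contributes \<open>card e = m\<close> equal summands, which cancel
        modulo \<open>m\<close>.\<close>
      also have "finsum ?R (\<lambda>w. \<ominus>\<^bsub>?R\<^esub> x (p w1)) e = \<zero>\<^bsub>?R\<^esub>"
        using R.add.finprod_const[of "\<ominus>\<^bsub>?R\<^esub> x (p w1)" e]
          ZFact_card_mult[of "\<ominus>\<^bsub>?R\<^esub> x (p w1)" m]
        by (simp add: x pv w1 card)
      also have "\<zero>\<^bsub>?R\<^esub> \<oplus>\<^bsub>?R\<^esub> \<zero>\<^bsub>?R\<^esub> = \<zero>\<^bsub>?R\<^esub>" by simp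
      finally show ?thesis .
    qed
    moreover have "?f x \<in> verts Hb \<rightarrow>\<^sub>E carrier ?R" "?f x w1 = \<zero>\<^bsub>?R\<^esub>"
      using w1 by (simp_all add: x pv R.minus_eq R.r_neg)
    ultimately show ?thesis
      unfolding PS0_carrier_iff[OF Hb] by blast
  qed
  have hom: "?f \<in> module_hom ?R (PS0 m H v1) (PS0 m Hb w1)"
  proof -
    have 1: "?f (x \<oplus>\<^bsub>PS0 m H v1\<^esub> y) = ?f x \<oplus>\<^bsub>PS0 m Hb w1\<^esub> ?f y"
      if "x \<in> carrier (PS0 m H v1)" "y \<in> carrier (PS0 m H v1)" for x y
    proof -
      have "x v \<in> carrier ?R" "y v \<in> carrier ?R" if "v \<in> verts H" for v
        using \<open>x \<in> _\<close> \<open>y \<in> _\<close> that by (auto simp: PS0_carrier_iff[OF H])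
      moreover have "(a \<oplus>\<^bsub>?R\<^esub> b) \<ominus>\<^bsub>?R\<^esub> (c \<oplus>\<^bsub>?R\<^esub> d) = (a \<ominus>\<^bsub>?R\<^esub> c) \<oplus>\<^bsub>?R\<^esub> (b \<ominus>\<^bsub>?R\<^esub> d)"
        if "a \<in> carrier ?R" "b \<in> carrier ?R" "c \<in> carrier ?R" "d \<in> carrier ?R" for a b c d
        using that by (simp add: R.minus_eq R.minus_add R.a_ac)
      ultimately show ?thesis
        unfolding PS0_simps by (intro restrict_ext) (simp add: pv w1)
    qed
    have 2: "?f (c \<odot>\<^bsub>PS0 m H v1\<^esub> x) = c \<odot>\<^bsub>PS0 m Hb w1\<^esub> ?f x"
      if "c \<in> carrier ?R" "x \<in> carrier (PS0 m H v1)" for c x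
    proof -
      have "x v \<in> carrier ?R" if "v \<in> verts H" for v
        using \<open>x \<in> _\<close> that by (auto simp: PS0_carrier_iff[OF H])
      then show ?thesis
        using that(1)
        unfolding PS0_simps by (intro restrict_ext) (simp add: pv w1 R.minus_eq R.r_distr R.r_minus)
    qed
    show ?thesis
      unfolding module_hom_def using closed 1 2 by blast
  qed
  have inj: "inj_on ?f (carrier (PS0 m H v1))"
  proof (rule inj_onI)
    fix x y assume "x \<in> carrier (PS0 m H v1)" "y \<in> carrier (PS0 m H v1)" and eq: "?f x = ?f y"
    then have x: "x \<in> verts H \<rightarrow>\<^sub>E carrier ?R" "x v1 = \<zero>\<^bsub>?R\<^esub>"
      and y: "y \<in> verts H \<rightarrow>\<^sub>E carrier ?R" "y v1 = \<zero>\<^bsub>?R\<^esub>"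
      by (simp_all add: PS0_carrier_iff[OF H])
    have cl: "x v \<in> carrier ?R" "y v \<in> carrier ?R" if "v \<in> verts H" for v
      using x y that by auto
    have eq': "x v \<ominus>\<^bsub>?R\<^esub> x (p w1) = y v \<ominus>\<^bsub>?R\<^esub> y (p w1)" if v: "v \<in> verts H" for v
    proof -
      obtain w where w: "v = p w" "w \<in> verts Hb"
        using v unfolding surj[symmetric] by (rule imageE)
      show ?thesis using fun_cong[OF eq, of w] by (simp add: w)
    qed
    \<comment> \<open>At \<open>v1\<close> both vectors vanish, so only the shifts remain there and
      must agree; they then cancel at every other vertex.\<close>
    have "\<ominus>\<^bsub>?R\<^esub> x (p w1) = \<ominus>\<^bsub>?R\<^esub> y (p w1)"
      using eq'[OF v1] x(2) y(2) by (simp add: R.minus_eq cl pv w1)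
    then have "x v = y v" if "v \<in> verts H" for v
      using eq'[OF that] that by (simp add: R.minus_eq cl pv w1)
    then show "x = y" by (rule PiE_ext[OF x(1) y(1)])
  qed
  have "module ?R (PS0 m H v1)" "module ?R (PS0 m Hb w1)"
    by (rule PS0_module[OF H v1], rule PS0_module[OF Hb w1])
  then show ?thesis
    unfolding embeds_as_submodule_def
    using hom inj module_hom_image_submodule by blast
qed

section \<open>The stabilizing group and its embedding along a covering\<close>

text \<open>Supplies the group structure on which Lagrange's theorem acts. Product and unit are
  restricted because the members of \<open>stabilizing_group\<close> are extensional.\<close>

definition stabilizing_group_monoid :: "nat \<Rightarrow> 'a hypergraph \<Rightarrow> 'a \<Rightarrow> ('a \<Rightarrow> complex) monoid" where
  "stabilizing_group_monoid m G v1 =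
     \<lparr>carrier = stabilizing_group m G v1,
      monoid.mult = (\<lambda>d d'. \<lambda>v\<in>verts G. d v * d' v), one = (\<lambda>v\<in>verts G. 1)\<rparr>"

text \<open>For a tuple of length \<open>m\<close>, this is the factor by which passing to the
  scaled tensor multiplies the entry at \<open>is\<close>. Isolating it exposes a quantity
  multiplicative in \<open>d\<close>.\<close>

definition diag_weight :: "('a \<Rightarrow> complex) \<Rightarrow> 'a list \<Rightarrow> complex" where
  "diag_weight d is = d (hd is) powi (- (int (length is) - 1)) * prod_list (map d (tl is))"

lemma diag_weight_mult: "diag_weight (\<lambda>v. d v * d' v) is = diag_weight d is * diag_weight d' is"
proof -
  have "prod_list (map (\<lambda>v. d v * d' v) xs) = prod_list (map d xs) * prod_list (map d' xs)" for xs
    by (induction xs) auto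
  then show ?thesis by (simp add: diag_weight_def power_int_mult_distrib)
qed

text \<open>The negative power at the head cancels the product over the tail. This is the
  multiplicative counterpart of \<open>m\<close> equal summands vanishing modulo \<open>m\<close>.
  For the empty list the exponent would be 1 and the weight \<open>c\<close>.\<close>

lemma diag_weight_const:
  assumes "is \<noteq> []" and "c \<noteq> 0"
  shows "diag_weight (\<lambda>v. c) is = 1"
proof -
  have "int (length is) - 1 = int (length (tl is))" using assms(1) by (cases "is") auto
  then show ?thesis
    using assms(2)
    by (simp add: diag_weight_def power_int_minus map_replicate_const del: length_tl)
qed

lemma diag_weight_inverse: "diag_weight (\<lambda>v. inverse (d v)) is = inverse (diag_weight d is)"
proof -
  have "prod_list (map (\<lambda>v. inverse (d v)) xs) = inverse (prod_list (map d xs))" for xs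
    by (induction xs) auto
  then show ?thesis by (simp add: diag_weight_def power_int_inverse)
qed

lemma diag_weight_map: "is \<noteq> [] \<Longrightarrow> diag_weight d (map p is) = diag_weight (\<lambda>w. d (p w)) is"
  by (cases "is") (simp_all add: diag_weight_def comp_def)

lemma diag_weight_cong:
  assumes "is \<noteq> []" and "\<And>v. v \<in> set is \<Longrightarrow> d v = d' v"
  shows "diag_weight d is = diag_weight d' is"
proof -
  have "map d (tl is) = map d' (tl is)"
    using assms by (auto intro: list.set_sel(2))
  then show ?thesis using assms by (simp add: diag_weight_def del: map_eq_conv)
qed

text \<open>At tuples that do not span an edge both tensors are zero; at the others the common
  nonzero entry \<open>1 / fact (m - 1)\<close> cancels.\<close>

lemma stabilizing_group_iff:
  "d \<in> stabilizing_group m G v1 \<longleftrightarrow>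
     d \<in> verts G \<rightarrow>\<^sub>E (UNIV - {0}) \<and>
     (\<forall>is\<in>tensor_indices m (verts G). set is \<in> edges G \<longrightarrow> diag_weight d is = 1) \<and> d v1 = 1"
proof -
  have "diag_scaled_tensor m d (adjacency_tensor m G) is = adjacency_tensor m G is \<longleftrightarrow>
      (set is \<in> edges G \<longrightarrow> diag_weight d is = 1)" if "is \<in> tensor_indices m (verts G)" for "is"
    using that
    by (auto simp: diag_scaled_tensor_def adjacency_tensor_def diag_weight_def tensor_indices_def
        field_simps)
  then show ?thesis by (auto simp: stabilizing_group_def)
qed

text \<open>The conditions of weight one survive products and inverses because the weight is
  multiplicative in \<open>d\<close>. Positivity of \<open>m\<close> makes every tuple nonempty, so
  that its head is a vertex.\<close>

lemma stabilizing_group_monoid_group: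
  assumes "m > 0" and "v1 \<in> verts G"
  shows "group (stabilizing_group_monoid m G v1)"
proof -
  have ne: "is \<noteq> []" "set is \<subseteq> verts G" if "is \<in> tensor_indices m (verts G)" for "is"
    using that assms by (auto simp: tensor_indices_def)
  have restr: "diag_weight (restrict d (verts G)) is = diag_weight d is"
    if "is \<in> tensor_indices m (verts G)" for d "is"
    using ne[OF that] by (intro diag_weight_cong) auto
  have one: "(\<lambda>v\<in>verts G. 1) \<in> stabilizing_group m G v1"
    using assms ne by (auto simp: stabilizing_group_iff restr diag_weight_const)
  have mult: "(\<lambda>v\<in>verts G. d v * d' v) \<in> stabilizing_group m G v1"
    if "d \<in> stabilizing_group m G v1" "d' \<in> stabilizing_group m G v1" for d d'
    using that assms
    by (auto simp: stabilizing_group_iff restr diag_weight_mult PiE_iff)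
  have inv: "(\<lambda>v\<in>verts G. inverse (d v)) \<in> stabilizing_group m G v1"
    if "d \<in> stabilizing_group m G v1" for d
    using that assms
    by (auto simp: stabilizing_group_iff restr diag_weight_inverse PiE_iff)
  have nz: "d v \<noteq> 0" if "d \<in> stabilizing_group m G v1" "v \<in> verts G" for d v
    using that by (auto simp: stabilizing_group_iff)
  have ext: "d \<in> extensional (verts G)" if "d \<in> stabilizing_group m G v1" for d
    using that by (auto simp: stabilizing_group_iff PiE_def)
  show ?thesis
  proof (rule groupI, goal_cases)
    case (5 d)
    then show ?case
      using inv[of d] nz[of d]
      by (intro bexI[of _ "\<lambda>v\<in>verts G. inverse (d v)"])
        (auto simp: stabilizing_group_monoid_def intro!: restrict_ext)
  next
    case (4 d)
    then show ?case
      using ext by (intro extensionalityI[of _ "verts G"]) (auto simp: stabilizing_group_monoid_def)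
  qed (auto simp: stabilizing_group_monoid_def one mult intro!: restrict_ext)
qed

lemma stabilizing_index_dvd_covering:
  assumes m: "m > 0" and Hb: "uniform_hypergraph m Hb"
    and p: "covering_projection Hb H p"
    and v1: "v1 \<in> verts H" and w1: "w1 \<in> verts Hb"
  shows "stabilizing_index m H v1 dvd stabilizing_index m Hb w1"
proof -
  let ?S = "stabilizing_group_monoid m H v1" and ?Sb = "stabilizing_group_monoid m Hb w1"
  let ?f = "\<lambda>d. \<lambda>w\<in>verts Hb. d (p w) * inverse (d (p w1))"
  interpret S: group ?S by (rule stabilizing_group_monoid_group[OF m v1])
  interpret Sb: group ?Sb by (rule stabilizing_group_monoid_group[OF m w1])
  have carrier [simp]: "carrier ?S = stabilizing_group m H v1"
    "carrier ?Sb = stabilizing_group m Hb w1"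
    by (simp_all add: stabilizing_group_monoid_def)
  have surj: "p ` verts Hb = verts H"
    using p by (simp add: covering_projection_def)
  then have pv: "p w \<in> verts H" if "w \<in> verts Hb" for w
    using that by blast
  have closed: "?f d \<in> stabilizing_group m Hb w1" if d: "d \<in> stabilizing_group m H v1" for d
  proof -
    have nz: "d v \<noteq> 0" if "v \<in> verts H" for v
      using d that by (auto simp: stabilizing_group_iff)
    have "diag_weight (?f d) is = 1"
      if "is \<in> tensor_indices m (verts Hb)" "set is \<in> edges Hb" for "is"
    proof -
      have ne: "is \<noteq> []" and sub: "set is \<subseteq> verts Hb" and len: "length is = m"
        using that(1) m by (auto simp: tensor_indices_def)
      have "diag_weight (?f d) is = diag_weight (\<lambda>w. d (p w) * inverse (d (p w1))) is"
        using ne sub by (intro diag_weight_cong) auto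
      \<comment> \<open>The normalizing factor is constant and nonzero, hence has weight
        one.\<close>
      also have "\<dots> = diag_weight (\<lambda>w. d (p w)) is"
        using diag_weight_mult[of "\<lambda>w. d (p w)" "\<lambda>w. inverse (d (p w1))" "is"] ne
        by (simp add: diag_weight_const nz pv w1)
      also have "\<dots> = diag_weight d (map p is)"
        by (simp add: diag_weight_map ne)
      also have "\<dots> = 1"
      proof -
        have "set (map p is) \<in> edges H"
          using p that(2) by (auto simp: covering_projection_def)
        moreover have "map p is \<in> tensor_indices m (verts H)"
          using sub len pv by (auto simp: tensor_indices_def)
        ultimately show ?thesis using d unfolding stabilizing_group_iff by blast
      qed
      finally show ?thesis .
    qed
    then show ?thesis
      using w1 by (auto simp: stabilizing_group_iff nz pv)
  qed
  have "?f \<in> hom ?S ?Sb"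
  proof (rule homI)
    show "?f (d \<otimes>\<^bsub>?S\<^esub> d') = ?f d \<otimes>\<^bsub>?Sb\<^esub> ?f d'" for d d'
      by (auto simp: stabilizing_group_monoid_def pv w1 intro!: restrict_ext)
  qed (simp add: closed)
  then interpret f: group_hom ?S ?Sb ?f
    by unfold_locales
  have "inj_on ?f (stabilizing_group m H v1)"
  proof (rule inj_onI)
    fix x y assume "x \<in> stabilizing_group m H v1" "y \<in> stabilizing_group m H v1"
      and eq: "?f x = ?f y"
    then have x: "x \<in> verts H \<rightarrow>\<^sub>E UNIV - {0}" "x v1 = 1"
      and y: "y \<in> verts H \<rightarrow>\<^sub>E UNIV - {0}" "y v1 = 1"
      by (auto simp: stabilizing_group_iff)
    have eq': "x v * inverse (x (p w1)) = y v * inverse (y (p w1))" if v: "v \<in> verts H" for v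
    proof -
      obtain w where w: "v = p w" "w \<in> verts Hb"
        using v unfolding surj[symmetric] by (rule imageE)
      show ?thesis using fun_cong[OF eq, of w] by (simp add: w)
    qed
    \<comment> \<open>Both functions equal one at \<open>v1\<close>, so comparing there identifies
      the normalizing factors.\<close>
    have "x (p w1) = y (p w1)" using eq'[OF v1] x(2) y(2) by simp
    moreover have "x (p w1) \<noteq> 0" using x(1) pv[OF w1] by auto
    ultimately have "x v = y v" if "v \<in> verts H" for v
      using eq'[OF that] by simp
    then show "x = y" by (rule PiE_ext[OF x(1) y(1)])
  qed
  then have "card (?f ` carrier ?S) = stabilizing_index m H v1"
    by (simp add: card_image stabilizing_index_def)
  \<comment> \<open>Lagrange's theorem rewrites the order as the number of cosets times the size of
    the image.\<close>
  moreover have "card (?f ` carrier ?S) dvd order ?Sb"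
    unfolding Sb.lagrange[OF f.img_is_subgroup, symmetric] by (rule dvd_triv_right)
  ultimately show ?thesis
    by (simp add: order_def stabilizing_index_def)
qed

theorem theorem4p5:
  fixes H :: "'a hypergraph" and Hb :: "'b hypergraph"
    and m k :: nat and v1 :: 'a and w1 :: 'b
  assumes "m > 0"
    and "uniform_hypergraph m H" and "connected_hypergraph H"
    and "uniform_hypergraph m Hb" and "connected_hypergraph Hb"
    and "k_fold_covering k Hb H"
    and "v1 \<in> verts H" and "w1 \<in> verts Hb"
  shows "embeds_as_submodule (ZFact (int m)) (PS0 m H v1) (PS0 m Hb w1) \<and>
         stabilizing_index m H v1 dvd stabilizing_index m Hb w1"
proof -
  obtain p where p: "covering_projection Hb H p"
    using assms(6) unfolding k_fold_covering_def by (elim exE conjE)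
  show ?thesis
    using PS0_embeds_covering[OF assms(2,4) p assms(7,8)]
      stabilizing_index_dvd_covering[OF assms(1,4) p assms(7,8)] by (rule conjI)
qed

end
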